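(* Let $[a,b]\subset\overline{\mathbb{R}}$ and let $f\in\mathcal{HK}_{[a,b]}$ and $g\in\mathcal{BV}_{[a,b]}$. Then $$\left|\int_a^bfg\right|\le\left|\int_a^bf\right|\inf_{[a,b]}|g|+\|f\|_{[a,b]}V_{[a,b]}g.$$
   Context: Functions are real-valued, $\overline{\mathbb{R}}=\mathbb{R}\cup\{\pm\infty\}$, and integrals are Henstock--Kurzweil integrals. $\mathcal{HK}_{[a,b]}$ is the set of functions Henstock--Kurzweil integrable over $[a,b]$; $\mathcal{BV}_{[a,b]}$ the functions of bounded variation on $[a,b]$; $V_{[a,b]}g$ the variation of $g$ over $[a,b]$. The Alexiewicz norm is $\|f\|_{[a,b]}=\sup_{I\subset[a,b]}\left|\int_If\right|$, the supremum being over all intervals $I\subset[a,b]$. *)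

theory Defs
  imports "HOL-Analysis.Analysis"
begin

text \<open>
  Functions live on intervals \<open>{a..b}\<close> of extended reals, and their values at infinity count for
  variations and infima. For integration only the real points matter: the integral over an unbounded
  set of reals is the limit of Henstock--Kurzweil integrals over compact intervals, which by Hake's
  theorem is the Henstock--Kurzweil integral over the extended interval, where tags at infinity
  contribute \<open>0\<close> to Riemann sums.
\<close>

definition real_points :: "ereal \<Rightarrow> ereal \<Rightarrow> real set" where
  "real_points a b = {x. a \<le> ereal x \<and> ereal x \<le> b}"

definition HK :: "ereal \<Rightarrow> ereal \<Rightarrow> (ereal \<Rightarrow> real) set" where
  "HK a b = {f. (\<lambda>x. f (ereal x)) integrable_on real_points a b}"

definition HK_integral :: "ereal \<Rightarrow> ereal \<Rightarrow> (ereal \<Rightarrow> real) \<Rightarrow> real" where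
  "HK_integral a b f = integral (real_points a b) (\<lambda>x. f (ereal x))"

text \<open>
  For \<open>f \<in> HK a b\<close> the supremum is that of a bounded set, since the primitive of \<open>f\<close> is
  continuous on the compact interval \<open>{a..b}\<close>.
\<close>

definition alexiewicz_norm :: "ereal \<Rightarrow> ereal \<Rightarrow> (ereal \<Rightarrow> real) \<Rightarrow> real" where
  "alexiewicz_norm a b f =
    (SUP I \<in> {I. is_interval I \<and> I \<subseteq> real_points a b}. \<bar>integral I (\<lambda>x. f (ereal x))\<bar>)"

definition variation_sums :: "ereal \<Rightarrow> ereal \<Rightarrow> (ereal \<Rightarrow> real) \<Rightarrow> real set" where
  "variation_sums a b g =
    {(\<Sum>i<n. \<bar>g (x (Suc i)) - g (x i)\<bar>) | (n::nat) x.
      mono_on {..n} x \<and> x ` {..n} \<subseteq> {a..b}}"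

definition BV :: "ereal \<Rightarrow> ereal \<Rightarrow> (ereal \<Rightarrow> real) set" where
  "BV a b = {g. bdd_above (variation_sums a b g)}"

definition variation :: "ereal \<Rightarrow> ereal \<Rightarrow> (ereal \<Rightarrow> real) \<Rightarrow> real" where
  "variation a b g = Sup (variation_sums a b g)"

end

theory Submission
  imports Defs
begin

text \<open>
  For any \<open>t \<in> {a..b}\<close> the integral of \<open>f g\<close> is \<open>g t \<integral> f\<close> plus the integral of \<open>f (g - g t)\<close>, so it
  suffices to bound the latter by the norm of \<open>f\<close> times the variation of \<open>g\<close>, and then to take the
  infimum over \<open>t\<close>.

  Put \<open>V x = variation a x g\<close>. Since \<open>V x + \<bar>g y - g x\<bar> \<le> V y\<close> for \<open>x \<le> y\<close>, both \<open>(V + g) / 2\<close> and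
  \<open>(V - g) / 2\<close> are increasing, and \<open>g - g t\<close> is the difference of these two functions, each
  normalised to vanish at \<open>t\<close>. The total increments of the two functions add up to \<open>V b\<close>. Hence all
  that is needed is that an increasing function \<open>p\<close> with a zero satisfies
  \<open>\<bar>\<integral> f p\<bar> \<le> (p b - p a) \<parallel>f\<parallel>\<close>. On a compact interval this is the second mean value theorem,
  \<open>\<integral> f p = p u \<integral>\<^sub>u\<^sup>c f + p v \<integral>\<^sub>c\<^sup>v f\<close>: the coefficients have opposite signs if \<open>p\<close> vanishes between
  \<open>u\<close> and \<open>v\<close>, and otherwise the two subintervals can be recombined.

  Unbounded intervals are treated by extending \<open>f\<close> by zero and the increasing functions by constants
  to the whole real line, where an integral is a limit of integrals over compact intervals. The
  integrals of \<open>f\<close> over intervals far from the origin are uniformly small, and the second mean value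
  theorem transfers this to \<open>f p\<close>; this gives the integrability of the product by the Cauchy
  criterion.
\<close>

section \<open>Integrals over the real line as limits over compact intervals\<close>

lemma ball_0_subset_interval_real:
  fixes B :: real
  assumes "0 < B"
  shows "ball 0 B \<subseteq> {c..d} \<longleftrightarrow> c \<le> - B \<and> B \<le> d"
  using assms by (simp add: ball_eq_greaterThanLessThan greaterThanLessThan_subseteq_atLeastAtMost_iff)

lemma integrable_on_UNIV_real_iff:
  fixes F :: "real \<Rightarrow> real"
  shows "F integrable_on UNIV \<longleftrightarrow>
    (\<forall>u v. F integrable_on {u..v}) \<and>
    (\<forall>e>0. \<exists>B>0. \<forall>c d c' d'. c \<le> - B \<and> B \<le> d \<and> c' \<le> - B \<and> B \<le> d' \<longrightarrow>
      \<bar>integral {c..d} F - integral {c'..d'} F\<bar> < e)"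
proof -
  let ?close = "\<lambda>e c d c' d'. \<bar>integral {c..d} F - integral {c'..d'} F\<bar> < e"
  have "(\<exists>B>0. \<forall>c d c' d'. ball 0 B \<subseteq> {c..d} \<and> ball 0 B \<subseteq> {c'..d'} \<longrightarrow> ?close e c d c' d')
      \<longleftrightarrow> (\<exists>B>0. \<forall>c d c' d'. c \<le> - B \<and> B \<le> d \<and> c' \<le> - B \<and> B \<le> d' \<longrightarrow> ?close e c d c' d')"
    for e
  proof (rule ex_cong1, rule conj_cong[OF refl])
    fix B :: real assume "0 < B"
    show "(\<forall>c d c' d'. ball 0 B \<subseteq> {c..d} \<and> ball 0 B \<subseteq> {c'..d'} \<longrightarrow> ?close e c d c' d')
      \<longleftrightarrow> (\<forall>c d c' d'. c \<le> - B \<and> B \<le> d \<and> c' \<le> - B \<and> B \<le> d' \<longrightarrow> ?close e c d c' d')"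
      by (simp only: ball_0_subset_interval_real[OF \<open>0 < B\<close>] conj_assoc)
  qed
  then show ?thesis
    unfolding integrable_alt[of F UNIV]
    by (simp only: UNIV_I if_True cbox_interval real_norm_def)
qed

text \<open>
  An interval beyond \<open>B\<close> is the difference of two intervals that contain \<open>{- B..B}\<close>, so this is
  the Cauchy criterion in a form that survives multiplication by a monotone function.
\<close>
lemma integral_tails_small:
  fixes F :: "real \<Rightarrow> real"
  assumes F: "F integrable_on UNIV" and "0 < e"
  obtains B where "0 < B" "\<And>u v. v \<le> - B \<or> B \<le> u \<Longrightarrow> \<bar>integral {u..v} F\<bar> < e"
proof -
  have int: "F integrable_on {u..v}" for u v
    using F by (simp add: integrable_on_UNIV_real_iff)
  obtain B where B: "0 < B"
    "\<And>c d c' d'. c \<le> - B \<Longrightarrow> B \<le> d \<Longrightarrow> c' \<le> - B \<Longrightarrow> B \<le> d' \<Longrightarrow>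
      \<bar>integral {c..d} F - integral {c'..d'} F\<bar> < e"
    using F \<open>0 < e\<close> unfolding integrable_on_UNIV_real_iff by meson
  have "\<bar>integral {u..v} F\<bar> < e" if uv: "v \<le> - B \<or> B \<le> u" for u v
  proof (cases "u \<le> v")
    case False
    then show ?thesis using \<open>0 < e\<close> by simp
  next
    case True
    from uv show ?thesis
    proof
      assume "v \<le> - B"
      then show ?thesis
        using Henstock_Kurzweil_Integration.integral_combine[of u v B F]
          B(2)[of u B v B] int True \<open>0 < B\<close> by auto
    next
      assume "B \<le> u"
      then show ?thesis
        using Henstock_Kurzweil_Integration.integral_combine[of "- B" u v F]
          B(2)[of "- B" v "- B" u] int True \<open>0 < B\<close> by auto
    qed
  qed
  then show thesis using that B(1) by blast
qed

lemma integrals_compact_intervals_bounded: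
  fixes F :: "real \<Rightarrow> real"
  assumes F: "F integrable_on UNIV"
  obtains K where "\<And>u v. \<bar>integral {u..v} F\<bar> \<le> K"
proof -
  have int: "F integrable_on {u..v}" for u v
    using F by (simp add: integrable_on_UNIV_real_iff)
  obtain B where B: "0 < B" "\<And>u v. v \<le> - B \<or> B \<le> u \<Longrightarrow> \<bar>integral {u..v} F\<bar> < 1"
    using integral_tails_small[OF F, of 1] by auto
  have "compact ((\<lambda>x. integral {- B..x} F) ` {- B..B})"
    by (intro compact_continuous_image indefinite_integral_continuous_1 int) simp
  then obtain L where L: "\<And>x. x \<in> {- B..B} \<Longrightarrow> \<bar>integral {- B..x} F\<bar> \<le> L"
    by (force dest!: compact_imp_bounded simp: bounded_iff)
  have "0 \<le> L" using L[of B] B(1) by auto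
  \<comment> \<open>the primitive based at \<open>- B\<close> is bounded by \<open>L + 1\<close> to the right of \<open>- B\<close>\<close>
  have right: "\<bar>integral {- B..x} F\<bar> \<le> L + 1" if "- B \<le> x" for x
  proof (cases "x \<le> B")
    case True
    then show ?thesis using L[of x] that by auto
  next
    case False
    then show ?thesis
      using Henstock_Kurzweil_Integration.integral_combine[of "- B" B x F]
        B(2)[of x B] L[of B] int B(1) by auto
  qed
  have "\<bar>integral {u..v} F\<bar> \<le> 2 * L + 2" for u v
  proof -
    consider "v < u" | "v \<le> - B" | "u \<le> v" "- B \<le> u" | "u < - B" "- B < v"
      by linarith
    then show ?thesis
    proof cases
      case 1
      then show ?thesis using \<open>0 \<le> L\<close> by simp
    next
      case 2
      then show ?thesis using B(2)[of v u] \<open>0 \<le> L\<close> by auto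
    next
      case 3
      then show ?thesis
        using Henstock_Kurzweil_Integration.integral_combine[of "- B" u v F]
          right[of u] right[of v] int by auto
    next
      case 4
      then show ?thesis
        using Henstock_Kurzweil_Integration.integral_combine[of u "- B" v F]
          B(2)[of "- B" u] right[of v] int \<open>0 \<le> L\<close> by auto
    qed
  qed
  then show thesis using that by blast
qed

text \<open>
  A nonempty bounded interval differs from the compact one between its infimum and supremum by at
  most two points; the empty one is \<open>{u..v}\<close> with \<open>v < u\<close>.
\<close>
lemma integral_bounded_interval_eq_compact:
  fixes F :: "real \<Rightarrow> real"
  assumes J: "is_interval J" "bounded J"
  obtains u v where "integral J F = integral {u..v} F"
proof (cases "J = {}")
  case True
  then show thesis using that[of 1 0] by simp
next
  case False
  have bdd: "bdd_below J" "bdd_above J"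
    using J(2) by (simp_all add: bounded_imp_bdd_below bounded_imp_bdd_above)
  have sub: "J \<subseteq> {Inf J..Sup J}"
    using bdd by (auto intro: cInf_lower cSup_upper)
  have sup: "{Inf J..Sup J} \<subseteq> J \<union> {Inf J, Sup J}"
  proof
    fix x assume x: "x \<in> {Inf J..Sup J}"
    show "x \<in> J \<union> {Inf J, Sup J}"
    proof (cases "Inf J < x \<and> x < Sup J")
      case True
      then obtain y z where "y \<in> J" "y < x" "z \<in> J" "x < z"
        using bdd False by (auto simp: cInf_less_iff less_cSup_iff)
      then show ?thesis
        using J(1) unfolding is_interval_1 by (meson UnI1 less_imp_le)
    qed (use x in auto)
  qed
  have "integral J F = integral {Inf J..Sup J} F"
    by (rule integral_spike_set; rule negligible_subset[of "{Inf J, Sup J}"])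
       (use sub sup in auto)
  then show thesis by (rule that)
qed

text \<open>
  Bounds are obtained below for compact intervals, whereas the Alexiewicz norm ranges over all
  intervals. An integral over \<open>I\<close> is the limit of the integrals over the bounded intervals
  \<open>I \<inter> {- B..B}\<close>; if it does not exist, its default value \<open>0\<close> satisfies the bound as well.
\<close>
lemma abs_integral_interval_le:
  fixes F :: "real \<Rightarrow> real"
  assumes le: "\<And>u v. \<bar>integral {u..v} F\<bar> \<le> K" and I: "is_interval I"
  shows "\<bar>integral I F\<bar> \<le> K"
proof (cases "F integrable_on I")
  case False
  then show ?thesis
    using le[of 1 0] by (simp add: not_integrable_integral)
next
  case True
  show ?thesis
  proof (rule field_le_epsilon)
    fix e :: real assume "0 < e"
    obtain B where B: "0 < B" "\<And>c d. ball 0 B \<subseteq> cbox c d \<Longrightarrow>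
        norm (integral (cbox c d) (\<lambda>x. if x \<in> I then F x else 0) - integral I F) < e"
      using integrable_integral[OF True] \<open>0 < e\<close> unfolding has_integral_alt' by meson
    have "\<bar>integral (I \<inter> {- B..B}) F - integral I F\<bar> < e"
      using B(2)[of "- B" B] B(1)
      by (simp add: ball_0_subset_interval_real Henstock_Kurzweil_Integration.integral_restrict_Int)
    moreover obtain u v where "integral (I \<inter> {- B..B}) F = integral {u..v} F"
      by (rule integral_bounded_interval_eq_compact[of "I \<inter> {- B..B}" F])
         (auto intro: is_interval_Int I is_interval_cc bounded_Int)
    ultimately show "\<bar>integral I F\<bar> \<le> K + e"
      using le[of u v] by linarith
  qed
qed

section \<open>Products with increasing functions\<close>

text \<open>
  The bounds \<open>\<alpha> \<le> 0 \<le> \<beta>\<close> stand for the extreme values of a function with a zero somewhere on the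
  line. The zero may lie outside \<open>{u..v}\<close>, so that \<open>G\<close> may keep one sign there, but the constant
  \<open>\<beta> - \<alpha>\<close> does not depend on \<open>{u..v}\<close>, as the passage to unbounded intervals requires.
\<close>
lemma abs_integral_mono_mult_le:
  fixes F G :: "real \<Rightarrow> real"
  assumes F: "F integrable_on {u..v}" and G: "mono G"
    and K: "\<And>p q. u \<le> p \<Longrightarrow> q \<le> v \<Longrightarrow> \<bar>integral {p..q} F\<bar> \<le> K"
    and G_ge: "\<And>x. \<alpha> \<le> G x" and G_le: "\<And>x. G x \<le> \<beta>" and "\<alpha> \<le> 0" "0 \<le> \<beta>"
  shows "(\<lambda>x. F x * G x) integrable_on {u..v}"
    and "\<bar>integral {u..v} (\<lambda>x. F x * G x)\<bar> \<le> (\<beta> - \<alpha>) * K"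
proof -
  have "(\<lambda>x. F x * G x) integrable_on {u..v} \<and>
    \<bar>integral {u..v} (\<lambda>x. F x * G x)\<bar> \<le> (\<beta> - \<alpha>) * K"
  proof (cases "u \<le> v")
    case False
    have "0 \<le> K" using K[of u v] by linarith
    with False show ?thesis
      using \<open>\<alpha> \<le> 0\<close> \<open>0 \<le> \<beta>\<close> by (simp add: integrable_on_empty)
  next
    case True
    obtain c where c: "c \<in> {u..v}"
      and has: "((\<lambda>x. G x * F x) has_integral (G u * integral {u..c} F + G v * integral {c..v} F)) {u..v}"
      using second_mean_value_theorem_full[OF F True, of G] G by (auto simp: mono_def)
    define A where "A = integral {u..c} F"
    define C where "C = integral {c..v} F"
    have AC: "A + C = integral {u..v} F"
      unfolding A_def C_def using c F by (intro Henstock_Kurzweil_Integration.integral_combine) auto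
    have A: "\<bar>A\<bar> \<le> K" unfolding A_def using c by (intro K) auto
    have C: "\<bar>C\<bar> \<le> K" unfolding C_def using c by (intro K) auto
    have S: "\<bar>A + C\<bar> \<le> K" unfolding AC by (intro K) auto
    have Guv: "G u \<le> G v" using G True by (rule monoD)
    have "0 \<le> K" using A by linarith
    have scale: "\<bar>r * y\<bar> \<le> \<bar>r\<bar> * K" if "\<bar>y\<bar> \<le> K" for r y
      using that by (simp add: abs_mult mult_left_mono)
    have "\<bar>G u * A + G v * C\<bar> \<le> (\<beta> - \<alpha>) * K"
    proof -
      consider "0 \<le> G u" | "G v \<le> 0" | "G u \<le> 0" "0 \<le> G v" by linarith
      then have "\<exists>m. \<bar>G u * A + G v * C\<bar> \<le> m * K \<and> m \<le> \<beta> - \<alpha>"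
      proof cases
        \<comment> \<open>if \<open>G\<close> keeps its sign, the coefficient of smaller modulus is applied to the whole integral\<close>
        case 1
        have "G u * A + G v * C = G u * (A + C) + (G v - G u) * C"
          by (simp add: algebra_simps)
        then have "\<bar>G u * A + G v * C\<bar> \<le> \<bar>G u\<bar> * K + \<bar>G v - G u\<bar> * K"
          using scale[OF S, of "G u"] scale[OF C, of "G v - G u"] by linarith
        also have "\<dots> = (G v) * K"
          using 1 Guv by (simp add: algebra_simps)
        finally show ?thesis
          using G_le[of v] \<open>\<alpha> \<le> 0\<close> by (intro exI[of _ "G v"]) auto
      next
        case 2
        have "G u * A + G v * C = G v * (A + C) + (G u - G v) * A"
          by (simp add: algebra_simps)
        then have "\<bar>G u * A + G v * C\<bar> \<le> \<bar>G v\<bar> * K + \<bar>G u - G v\<bar> * K"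
          using scale[OF S, of "G v"] scale[OF A, of "G u - G v"] by linarith
        also have "\<dots> = (- G u) * K"
          using 2 Guv by (simp add: algebra_simps)
        finally show ?thesis
          using G_ge[of u] \<open>0 \<le> \<beta>\<close> by (intro exI[of _ "- G u"]) auto
      next
        case 3
        have "\<bar>G u * A + G v * C\<bar> \<le> \<bar>G u\<bar> * K + \<bar>G v\<bar> * K"
          using scale[OF A, of "G u"] scale[OF C, of "G v"] by linarith
        also have "\<dots> = (G v - G u) * K"
          using 3 by (simp add: algebra_simps)
        finally show ?thesis
          using G_ge[of u] G_le[of v] by (intro exI[of _ "G v - G u"]) auto
      qed
      then show ?thesis
        using \<open>0 \<le> K\<close> by (meson mult_right_mono order_trans)
    qed
    with has show ?thesis
      unfolding A_def C_def by (auto simp: mult.commute has_integral_iff)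
  qed
  then show "(\<lambda>x. F x * G x) integrable_on {u..v}"
    and "\<bar>integral {u..v} (\<lambda>x. F x * G x)\<bar> \<le> (\<beta> - \<alpha>) * K" by auto
qed

lemma integrable_mono_mult_UNIV:
  fixes F G :: "real \<Rightarrow> real"
  assumes F: "F integrable_on UNIV" and G: "mono G"
    and G_ge: "\<And>x. \<alpha> \<le> G x" and G_le: "\<And>x. G x \<le> \<beta>" and "\<alpha> \<le> 0" "0 \<le> \<beta>"
  shows "(\<lambda>x. F x * G x) integrable_on UNIV"
proof -
  let ?H = "\<lambda>x. F x * G x"
  have intF: "F integrable_on {u..v}" for u v
    using F by (simp add: integrable_on_UNIV_real_iff)
  obtain K where K: "\<And>u v. \<bar>integral {u..v} F\<bar> \<le> K"
    using integrals_compact_intervals_bounded[OF F] by blast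
  have int: "?H integrable_on {u..v}" for u v
    by (rule abs_integral_mono_mult_le(1)[OF intF G K G_ge G_le]) fact+
  have "\<exists>B>0. \<forall>c d c' d'. c \<le> - B \<and> B \<le> d \<and> c' \<le> - B \<and> B \<le> d' \<longrightarrow>
      \<bar>integral {c..d} ?H - integral {c'..d'} ?H\<bar> < e" if "0 < e" for e
  proof -
    \<comment> \<open>the summand \<open>1\<close> keeps \<open>M\<close> positive when \<open>\<alpha> = \<beta>\<close>\<close>
    define M where "M = \<beta> - \<alpha> + 1"
    have "0 < M" using \<open>\<alpha> \<le> 0\<close> \<open>0 \<le> \<beta>\<close> by (simp add: M_def)
    \<comment> \<open>two large intervals exceed \<open>{- B..B}\<close> by two tails each, hence the \<open>4\<close>\<close>
    define \<delta> where "\<delta> = e / (4 * M)"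
    have "0 < \<delta>" using \<open>0 < M\<close> \<open>0 < e\<close> by (simp add: \<delta>_def)
    obtain B where B: "0 < B" "\<And>u v. v \<le> - B \<or> B \<le> u \<Longrightarrow> \<bar>integral {u..v} F\<bar> < \<delta>"
      using integral_tails_small[OF F \<open>0 < \<delta>\<close>] by blast
    have tail: "\<bar>integral {u..v} ?H\<bar> < e / 4" if uv: "v \<le> - B \<or> B \<le> u" for u v
    proof -
      have "\<bar>integral {u..v} ?H\<bar> \<le> (\<beta> - \<alpha>) * \<delta>"
      proof (rule abs_integral_mono_mult_le(2)[OF intF G _ G_ge G_le])
        show "\<bar>integral {p..q} F\<bar> \<le> \<delta>" if "u \<le> p" "q \<le> v" for p q
          using B(2)[of q p] uv that by linarith
      qed fact+
      also have "\<dots> < M * \<delta>" using \<open>0 < \<delta>\<close> by (simp add: M_def)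
      also have "\<dots> = e / 4" using \<open>0 < M\<close> by (simp add: \<delta>_def)
      finally show ?thesis .
    qed
    have near: "\<bar>integral {c..d} ?H - integral {- B..B} ?H\<bar> < e / 2" if "c \<le> - B" "B \<le> d" for c d
    proof -
      have "integral {c..- B} ?H + integral {- B..d} ?H = integral {c..d} ?H"
        "integral {- B..B} ?H + integral {B..d} ?H = integral {- B..d} ?H"
        using that B(1) by (auto intro!: Henstock_Kurzweil_Integration.integral_combine int)
      then show ?thesis
        using tail[of "- B" c] tail[of d B] by linarith
    qed
    show ?thesis
    proof (intro exI[of _ B] conjI allI impI)
      fix c d c' d' assume "c \<le> - B \<and> B \<le> d \<and> c' \<le> - B \<and> B \<le> d'"
      then have "\<bar>integral {c..d} ?H - integral {- B..B} ?H\<bar> < e / 2"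
        "\<bar>integral {c'..d'} ?H - integral {- B..B} ?H\<bar> < e / 2"
        by (blast intro: near)+
      then show "\<bar>integral {c..d} ?H - integral {c'..d'} ?H\<bar> < e"
        by linarith
    qed fact
  qed
  then show ?thesis unfolding integrable_on_UNIV_real_iff using int by blast
qed

section \<open>The variation as a function of the right end point\<close>

text \<open>
  The points \<open>x\<close> and \<open>y\<close> can be appended to any chain in \<open>{a..x}\<close>, giving a chain in \<open>{a..y}\<close>.
\<close>
lemma variation_add_increment_le:
  assumes "g \<in> BV a b" "a \<le> x" "x \<le> y" "y \<le> b"
  shows "variation a x g + \<bar>g y - g x\<bar> \<le> variation a y g"
proof -
  have "variation_sums a y g \<subseteq> variation_sums a b g"
    unfolding variation_sums_def using \<open>y \<le> b\<close> by fastforce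
  then have bdd: "bdd_above (variation_sums a y g)"
    using assms(1) unfolding BV_def by (auto intro: bdd_above_mono)
  have "s \<le> variation a y g - \<bar>g y - g x\<bar>" if s_in: "s \<in> variation_sums a x g" for s
  proof -
    obtain n :: nat and z where s: "s = (\<Sum>i<n. \<bar>g (z (Suc i)) - g (z i)\<bar>)"
      and z: "mono_on {..n} z" "z ` {..n} \<subseteq> {a..x}"
      using s_in unfolding variation_sums_def by blast
    define w where "w i = (if i \<le> n then z i else if i = Suc n then x else y)" for i
    have in_ax: "z i \<in> {a..x}" if "i \<le> n" for i
      using z(2) that by auto
    have "mono_on {..n + 2} w"
    proof (rule mono_onI)
      fix i j assume ij: "i \<in> {..n + 2}" "j \<in> {..n + 2}" "i \<le> j"
      have "z i \<le> x" "z i \<le> y" if "i \<le> n"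
        using in_ax[OF that] \<open>x \<le> y\<close> by (auto intro: order_trans)
      moreover have "z i \<le> z j" if "j \<le> n"
        using z(1) that ij by (auto intro: mono_onD)
      ultimately show "w i \<le> w j"
        using ij \<open>x \<le> y\<close> by (auto simp: w_def)
    qed
    moreover have "w ` {..n + 2} \<subseteq> {a..y}"
      using in_ax \<open>a \<le> x\<close> \<open>x \<le> y\<close> unfolding w_def by (force intro: order_trans)
    ultimately have "(\<Sum>i<n + 2. \<bar>g (w (Suc i)) - g (w i)\<bar>) \<in> variation_sums a y g"
      unfolding variation_sums_def by blast
    then have "(\<Sum>i<n + 2. \<bar>g (w (Suc i)) - g (w i)\<bar>) \<le> variation a y g"
      unfolding variation_def using bdd by (rule cSup_upper)
    moreover have "(\<Sum>i<n. \<bar>g (w (Suc i)) - g (w i)\<bar>) = s"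
      unfolding s by (rule sum.cong) (auto simp: w_def)
    ultimately show ?thesis by (simp add: w_def)
  qed
  moreover have "variation_sums a x g \<noteq> {}"
  proof -
    have "(\<Sum>i<0. \<bar>g x - g x\<bar>) \<in> variation_sums a x g"
      unfolding variation_sums_def using \<open>a \<le> x\<close>
      by (intro CollectI exI[of _ "0::nat"] exI[of _ "\<lambda>_. x"]) (auto intro: mono_onI)
    then show ?thesis by blast
  qed
  ultimately have "variation a x g \<le> variation a y g - \<bar>g y - g x\<bar>"
    unfolding variation_def by (intro cSup_least)
  then show ?thesis by simp
qed

lemma variation_singleton: "variation a a g = 0"
proof -
  have "variation_sums a a g = {0}"
  proof
    show "variation_sums a a g \<subseteq> {0}"
    proof
      fix s assume "s \<in> variation_sums a a g"
      then obtain n :: nat and z where s: "s = (\<Sum>i<n. \<bar>g (z (Suc i)) - g (z i)\<bar>)"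
        and z: "z ` {..n} \<subseteq> {a..a}"
        unfolding variation_sums_def by auto
      have "z i = a" if "i \<le> n" for i using z that by auto
      then show "s \<in> {0}" unfolding s by simp
    qed
    show "{0} \<subseteq> variation_sums a a g"
      unfolding variation_sums_def
      by (auto intro!: exI[of _ "0::nat"] exI[of _ "\<lambda>_. a"] mono_onI)
  qed
  then show ?thesis by (simp add: variation_def)
qed

section \<open>The product inequality\<close>

lemma is_interval_real_points: "is_interval (real_points a b)"
  unfolding is_interval_1 real_points_def
  by (auto intro: order_trans simp flip: ereal_less_eq(3))

text \<open>
  The supremum that defines the norm is over a bounded set, because \<open>f\<close> extended by zero has bounded
  integrals over compact intervals.
\<close>
lemma integral_le_alexiewicz_norm:
  assumes f: "f \<in> HK a b" and I: "is_interval I" "I \<subseteq> real_points a b"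
  shows "\<bar>integral I (\<lambda>x. f (ereal x))\<bar> \<le> alexiewicz_norm a b f"
proof -
  let ?S = "real_points a b"
  let ?F = "\<lambda>x. if x \<in> ?S then f (ereal x) else 0"
  have "?F integrable_on UNIV"
    using f unfolding HK_def by (simp add: Henstock_Kurzweil_Integration.integrable_restrict_UNIV)
  then obtain K where K: "\<And>u v. \<bar>integral {u..v} ?F\<bar> \<le> K"
    using integrals_compact_intervals_bounded by blast
  have "\<bar>integral J (\<lambda>x. f (ereal x))\<bar> \<le> K" if "is_interval J" "J \<subseteq> ?S" for J
  proof -
    have "integral J (\<lambda>x. f (ereal x)) = integral J ?F"
      using that(2) by (intro Henstock_Kurzweil_Integration.integral_cong) auto
    then show ?thesis using abs_integral_interval_le[OF K that(1)] by simp
  qed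
  then have "bdd_above ((\<lambda>I. \<bar>integral I (\<lambda>x. f (ereal x))\<bar>) ` {I. is_interval I \<and> I \<subseteq> ?S})"
    by (auto intro!: bdd_aboveI)
  then show ?thesis
    unfolding alexiewicz_norm_def using I by (intro cSUP_upper) auto
qed

text \<open>
  Clamping the argument to \<open>{a..b}\<close> extends \<open>p\<close> to an increasing function on the line with values
  between \<open>p a\<close> and \<open>p b\<close>, also when \<open>a\<close> or \<open>b\<close> is infinite. The zero of \<open>p\<close> is what makes these
  values have opposite signs; without it nonzero constants \<open>p\<close> would violate the bound.
\<close>
lemma HK_mono_mult:
  assumes f: "f \<in> HK a b" and p: "mono_on {a..b} p" and t: "t \<in> {a..b}" "p t = 0"
  shows "(\<lambda>x. f x * p x) \<in> HK a b"
    and "\<bar>HK_integral a b (\<lambda>x. f x * p x)\<bar> \<le> (p b - p a) * alexiewicz_norm a b f"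
proof -
  let ?S = "real_points a b"
  define F where "F = (\<lambda>x. if x \<in> ?S then f (ereal x) else 0)"
  define G where "G x = p (max a (min b (ereal x)))" for x
  have "a \<le> b" using t by auto
  then have clamp: "max a (min b x) \<in> {a..b}" for x by auto
  have pD: "p x \<le> p y" if "x \<in> {a..b}" "y \<in> {a..b}" "x \<le> y" for x y
    using p that by (rule mono_onD)
  have F: "F integrable_on UNIV"
    using f unfolding HK_def F_def
    by (simp add: Henstock_Kurzweil_Integration.integrable_restrict_UNIV)
  have G: "mono G"
    unfolding G_def by (intro monoI pD clamp max.mono min.mono) auto
  have G_ge: "p a \<le> G x" and G_le: "G x \<le> p b" for x
    unfolding G_def using clamp[of "ereal x"] \<open>a \<le> b\<close> by (auto intro!: pD)
  have signs: "p a \<le> 0" "0 \<le> p b"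
    using pD[of a t] pD[of t b] t by auto
  have K: "\<bar>integral {u..v} F\<bar> \<le> alexiewicz_norm a b f" for u v
    unfolding F_def Henstock_Kurzweil_Integration.integral_restrict_Int
    by (intro integral_le_alexiewicz_norm f is_interval_Int is_interval_real_points is_interval_cc) auto
  have FG: "(\<lambda>x. F x * G x) = (\<lambda>x. if x \<in> ?S then f (ereal x) * p (ereal x) else 0)"
    by (auto simp: F_def G_def real_points_def fun_eq_iff max_absorb2 min_absorb2)
  have "(\<lambda>x. F x * G x) integrable_on UNIV"
    by (rule integrable_mono_mult_UNIV[OF F G G_ge G_le signs])
  then show "(\<lambda>x. f x * p x) \<in> HK a b"
    unfolding HK_def FG by (simp add: Henstock_Kurzweil_Integration.integrable_restrict_UNIV)
  have "\<bar>integral {u..v} (\<lambda>x. F x * G x)\<bar> \<le> (p b - p a) * alexiewicz_norm a b f" for u v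
  proof (rule abs_integral_mono_mult_le(2)[OF _ G K G_ge G_le signs])
    show "F integrable_on {u..v}" using F by (simp add: integrable_on_UNIV_real_iff)
  qed
  then have "\<bar>integral UNIV (\<lambda>x. F x * G x)\<bar> \<le> (p b - p a) * alexiewicz_norm a b f"
    by (rule abs_integral_interval_le) simp
  then show "\<bar>HK_integral a b (\<lambda>x. f x * p x)\<bar> \<le> (p b - p a) * alexiewicz_norm a b f"
    unfolding HK_integral_def FG by (simp add: Henstock_Kurzweil_Integration.integral_restrict_UNIV)
qed

text \<open>
  The Jordan decomposition of \<open>g - g t\<close> into \<open>p - n\<close> is normalised at \<open>t\<close> rather than at \<open>a\<close>, so
  that the whole interval can be treated at once, without splitting the integral at \<open>t\<close>.
\<close>
lemma HK_BV_mult_at_point: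
  assumes f: "f \<in> HK a b" and g: "g \<in> BV a b" and t: "t \<in> {a..b}"
  shows "(\<lambda>x. f x * g x) \<in> HK a b"
    and "\<bar>HK_integral a b (\<lambda>x. f x * g x)\<bar>
      \<le> \<bar>HK_integral a b f\<bar> * \<bar>g t\<bar> + alexiewicz_norm a b f * variation a b g"
proof -
  let ?S = "real_points a b"
  define V where "V x = variation a x g" for x
  define p where "p x = (V x + g x) / 2 - (V t + g t) / 2" for x
  define n where "n x = (V x - g x) / 2 - (V t - g t) / 2" for x
  have inc: "\<bar>g y - g x\<bar> \<le> V y - V x" if "x \<in> {a..b}" "y \<in> {a..b}" "x \<le> y" for x y
    using variation_add_increment_le[OF g, of x y] that by (simp add: V_def)
  have "p x \<le> p y" if "x \<in> {a..b}" "y \<in> {a..b}" "x \<le> y" for x y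
    using inc[OF that, unfolded abs_le_iff] by (simp add: p_def)
  moreover have "n x \<le> n y" if "x \<in> {a..b}" "y \<in> {a..b}" "x \<le> y" for x y
    using inc[OF that, unfolded abs_le_iff] by (simp add: n_def)
  ultimately have mono: "mono_on {a..b} p" "mono_on {a..b} n"
    by (auto intro: mono_onI)
  have 0: "p t = 0" "n t = 0" by (auto simp: p_def n_def)
  note P = HK_mono_mult[OF f mono(1) t 0(1)]
  note N = HK_mono_mult[OF f mono(2) t 0(2)]
  have split: "f x * g x = f x * g t + f x * p x - f x * n x" for x
    by (simp add: p_def n_def field_simps)
  have intf: "(\<lambda>x. f (ereal x)) integrable_on ?S"
    and intp: "(\<lambda>x. f (ereal x) * p (ereal x)) integrable_on ?S"
    and intn: "(\<lambda>x. f (ereal x) * n (ereal x)) integrable_on ?S"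
    using f P(1) N(1) by (auto simp: HK_def)
  have intt: "(\<lambda>x. f (ereal x) * g t) integrable_on ?S"
    using intf by (rule integrable_on_mult_left)
  show "(\<lambda>x. f x * g x) \<in> HK a b"
    unfolding HK_def split using intt intp intn
    by (auto intro!: integrable_diff Henstock_Kurzweil_Integration.integrable_add)
  have eq: "HK_integral a b (\<lambda>x. f x * g x) = HK_integral a b f * g t
      + HK_integral a b (\<lambda>x. f x * p x) - HK_integral a b (\<lambda>x. f x * n x)"
    unfolding HK_integral_def split using intt intp intn
    by (simp add: Henstock_Kurzweil_Integration.integral_diff
      Henstock_Kurzweil_Integration.integral_add Henstock_Kurzweil_Integration.integrable_add)
  have total: "(p b - p a) + (n b - n a) = variation a b g"
    by (simp add: p_def n_def V_def variation_singleton field_simps)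
  have "\<bar>HK_integral a b (\<lambda>x. f x * g x)\<bar> \<le> \<bar>HK_integral a b f * g t\<bar>
      + ((p b - p a) * alexiewicz_norm a b f + (n b - n a) * alexiewicz_norm a b f)"
    unfolding eq using P(2) N(2) by linarith
  also have "\<dots> = \<bar>HK_integral a b f\<bar> * \<bar>g t\<bar> + alexiewicz_norm a b f * variation a b g"
    unfolding total[symmetric] by (simp add: abs_mult algebra_simps)
  finally show "\<bar>HK_integral a b (\<lambda>x. f x * g x)\<bar>
      \<le> \<bar>HK_integral a b f\<bar> * \<bar>g t\<bar> + alexiewicz_norm a b f * variation a b g" .
qed

theorem lemma24:
  fixes a b :: ereal and f g :: "ereal \<Rightarrow> real"
  assumes "a \<le> b" and "f \<in> HK a b" and "g \<in> BV a b"
  shows "(\<lambda>x. f x * g x) \<in> HK a b \<and>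
    \<bar>HK_integral a b (\<lambda>x. f x * g x)\<bar>
      \<le> \<bar>HK_integral a b f\<bar> * (INF x\<in>{a..b}. \<bar>g x\<bar>) + alexiewicz_norm a b f * variation a b g"
proof
  let ?L = "\<bar>HK_integral a b (\<lambda>x. f x * g x)\<bar>"
  let ?c = "\<bar>HK_integral a b f\<bar>"
  let ?r = "alexiewicz_norm a b f * variation a b g"
  show "(\<lambda>x. f x * g x) \<in> HK a b"
    using HK_BV_mult_at_point(1)[OF assms(2,3), of a] assms(1) by simp
  have le: "?L \<le> ?c * \<bar>g t\<bar> + ?r" if "t \<in> {a..b}" for t
    by (rule HK_BV_mult_at_point(2)[OF assms(2,3) that])
  have ne: "{a..b} \<noteq> {}" using assms(1) by simp
  show "?L \<le> ?c * (INF x\<in>{a..b}. \<bar>g x\<bar>) + ?r"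
  proof (cases "?c = 0")
    case True
    then show ?thesis using le[of a] assms(1) by simp
  next
    case False
    then have "0 < ?c" by simp
    have "(?L - ?r) / ?c \<le> (INF x\<in>{a..b}. \<bar>g x\<bar>)"
    proof (rule cINF_greatest[OF ne])
      fix t assume "t \<in> {a..b}"
      from le[OF this] show "(?L - ?r) / ?c \<le> \<bar>g t\<bar>"
        using \<open>0 < ?c\<close> by (simp add: pos_divide_le_eq mult.commute)
    qed
    then show ?thesis
      using \<open>0 < ?c\<close> by (simp add: pos_divide_le_eq mult.commute)
  qed
qed

end
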